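(* For every positive integer $d$ and every finite $d$-regular graph $G$, the separation dimension of $G$ satisfies $\pi(G) \leq 2^{9 \log^* d}\, d$. Equivalently, $f(d) \leq 2^{9\log^* d}\, d$, where $f(d)$ denotes the maximum separation dimension of a (finite) $d$-regular graph.
   Context: For a permutation (total order) $\sigma$ of a finite set $U$ and disjoint subsets $A,B\subseteq U$, write $A \prec_\sigma B$ if every element of $A$ precedes every element of $B$ in $\sigma$; $\sigma$ separates $A$ and $B$ if $A\prec_\sigma B$ or $B\prec_\sigma A$. A family $\mathcal{F}$ of permutations of $V(G)$ is pairwise suitable for a graph $G$ if for every two disjoint edges $e,f$ of $G$ (viewed as 2-element vertex sets) some $\sigma\in\mathcal{F}$ separates $e$ and $f$. The separation dimension $\pi(G)$ is the minimum cardinality of a family of permutations pairwise suitable for $G$. Logarithms are base 2, and $\log^* x$ is the iterated logarithm: $\log^* x = 0$ for $x\le 1$ and $\log^* x = 1+\log^*(\log x)$ for $x>1$. *)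

theory Defs
  imports Complex_Main
begin

definition graph :: "'a set \<Rightarrow> 'a set set \<Rightarrow> bool" where
  "graph V E \<longleftrightarrow> finite V \<and> (\<forall>e\<in>E. e \<subseteq> V \<and> card e = 2)"

definition regular :: "nat \<Rightarrow> 'a set \<Rightarrow> 'a set set \<Rightarrow> bool" where
  "regular d V E \<longleftrightarrow> (\<forall>v\<in>V. card {e\<in>E. v \<in> e} = d)"

definition is_perm :: "'a set \<Rightarrow> 'a list \<Rightarrow> bool" where
  "is_perm V \<sigma> \<longleftrightarrow> distinct \<sigma> \<and> set \<sigma> = V"

definition precedes :: "'a list \<Rightarrow> 'a set \<Rightarrow> 'a set \<Rightarrow> bool" where
  "precedes \<sigma> A B \<longleftrightarrow> (\<forall>a\<in>A. \<forall>b\<in>B. \<exists>i j. i < j \<and> j < length \<sigma> \<and> \<sigma> ! i = a \<and> \<sigma> ! j = b)"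

definition separates :: "'a list \<Rightarrow> 'a set \<Rightarrow> 'a set \<Rightarrow> bool" where
  "separates \<sigma> A B \<longleftrightarrow> precedes \<sigma> A B \<or> precedes \<sigma> B A"

definition pairwise_suitable :: "'a set \<Rightarrow> 'a set set \<Rightarrow> 'a list set \<Rightarrow> bool" where
  "pairwise_suitable V E F \<longleftrightarrow> (\<forall>\<sigma>\<in>F. is_perm V \<sigma>) \<and>
     (\<forall>e\<in>E. \<forall>f\<in>E. e \<inter> f = {} \<longrightarrow> (\<exists>\<sigma>\<in>F. separates \<sigma> e f))"

definition separation_dim :: "'a set \<Rightarrow> 'a set set \<Rightarrow> nat" where
  "separation_dim V E = (LEAST k. \<exists>F. finite F \<and> card F = k \<and> pairwise_suitable V E F)"

definition logstar :: "real \<Rightarrow> nat" where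
  "logstar x = (LEAST k. ((log 2) ^^ k) x \<le> 1)"

end

theory Submission
  imports Defs "HOL-Library.FuncSet"
begin

text \<open>Let \<open>f d\<close> be the largest separation dimension for maximum degree at most \<open>d\<close>. Colour the
  vertices with \<open>r = O(d / log d)\<close> colours so that every closed neighbourhood contains each colour
  at most \<open>t = \<lfloor>log d / 2\<rfloor>\<close> times. Grouping the pairs of colours \<open>{i, j}\<close> by \<open>i + j\<close> mod \<open>r\<close> yields \<open>r\<close>
  subgraphs of maximum degree at most \<open>2 * t - 1\<close>, which handle all pairs of edges that together use
  at most two colours. The remaining pairs are handled by \<open>4 * r\<close> orders that move a single
  colour block. Hence \<open>f d \<le> r * f (2 * t - 1) + 4 * r\<close>, and every such step costs a factor of less than
  \<open>2 ^ 9\<close> while \<open>log\<close> is applied once.\<close>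

section \<open>From integer keys to permutations\<close>

text \<open>Permutations are replaced by integer keys, which need not be injective: sorting by a key
  breaks ties arbitrarily and preserves every strict separation.\<close>

definition sep_family :: "'a set set \<Rightarrow> nat \<Rightarrow> bool" where
  "sep_family E n \<longleftrightarrow> (\<exists>G :: ('a \<Rightarrow> int) set. finite G \<and> card G \<le> n \<and>
     (\<forall>e\<in>E. \<forall>f\<in>E. e \<inter> f = {} \<longrightarrow>
        (\<exists>g\<in>G. (\<forall>a\<in>e. \<forall>b\<in>f. g a < g b) \<or> (\<forall>a\<in>e. \<forall>b\<in>f. g b < g a))))"

lemma sep_family_mono: "sep_family E m \<Longrightarrow> m \<le> n \<Longrightarrow> sep_family E n"
  unfolding sep_family_def
  by (elim exE, rule_tac x = G in exI, elim conjE, intro conjI) (assumption, erule (1) le_trans, assumption)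

lemma precedes_sort_key:
  fixes g :: "'a \<Rightarrow> int"
  assumes "set xs = V" "A \<subseteq> V" "B \<subseteq> V" "\<And>a b. a \<in> A \<Longrightarrow> b \<in> B \<Longrightarrow> g a < g b"
  shows "precedes (sort_key g xs) A B"
  unfolding precedes_def
proof (intro ballI)
  fix a b assume ab: "a \<in> A" "b \<in> B"
  let ?ys = "sort_key g xs"
  have "a \<in> set ?ys" "b \<in> set ?ys" using ab assms by auto
  then obtain i j where i: "i < length ?ys" "?ys ! i = a" and j: "j < length ?ys" "?ys ! j = b"
    by (metis in_set_conv_nth)
  have "i < j"
  proof (rule ccontr)
    assume "\<not> i < j"
    then have "map g ?ys ! j \<le> map g ?ys ! i"
      using i j by (intro sorted_nth_mono) (auto simp del: length_sort)
    then show False using i j assms(4)[OF ab] by simp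
  qed
  then show "\<exists>i j. i < j \<and> j < length ?ys \<and> ?ys ! i = a \<and> ?ys ! j = b"
    using i j by blast
qed

text \<open>Sorting one fixed enumeration of \<open>V\<close> by each key yields the permutations.
  Different keys may produce the same order, which only lowers the cardinality.\<close>

lemma separation_dim_le:
  assumes "graph V E" "sep_family E n"
  shows "separation_dim V E \<le> n"
proof -
  have "finite V" using assms(1) by (simp add: graph_def)
  then obtain xs where xs: "set xs = V" "distinct xs"
    using finite_distinct_list by metis
  from assms(2) obtain G :: "('a \<Rightarrow> int) set" where G: "finite G" "card G \<le> n"
    and sep: "\<forall>e\<in>E. \<forall>f\<in>E. e \<inter> f = {} \<longrightarrow>
        (\<exists>g\<in>G. (\<forall>a\<in>e. \<forall>b\<in>f. g a < g b) \<or> (\<forall>a\<in>e. \<forall>b\<in>f. g b < g a))"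
    unfolding sep_family_def by (elim exE conjE)
  define F where "F = (\<lambda>g. sort_key g xs) ` G"
  have sub: "e \<subseteq> V" if "e \<in> E" for e using assms(1) that by (simp add: graph_def)
  have "\<exists>\<sigma>\<in>F. separates \<sigma> e f" if ef: "e \<in> E" "f \<in> E" "e \<inter> f = {}" for e f
  proof -
    from sep ef obtain g where "g \<in> G"
      and g: "(\<forall>a\<in>e. \<forall>b\<in>f. g a < g b) \<or> (\<forall>a\<in>e. \<forall>b\<in>f. g b < g a)" by blast
    have "separates (sort_key g xs) e f"
      using g precedes_sort_key[OF xs(1), of e f g] precedes_sort_key[OF xs(1), of f e g]
        sub[OF ef(1)] sub[OF ef(2)] unfolding separates_def by blast
    then show ?thesis using \<open>g \<in> G\<close> unfolding F_def by blast
  qed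
  moreover have "\<forall>\<sigma>\<in>F. is_perm V \<sigma>" using xs by (auto simp: F_def is_perm_def)
  ultimately have "pairwise_suitable V E F" unfolding pairwise_suitable_def by blast
  moreover have "finite F" using G by (simp add: F_def)
  ultimately have "separation_dim V E \<le> card F"
    unfolding separation_dim_def by (intro Least_le) blast
  also have "\<dots> \<le> card G" using G by (simp add: F_def card_image_le)
  finally show ?thesis using G by simp
qed

text \<open>An upper bound replaces regularity because the induction passes to subgraphs, which need
  not be regular.\<close>

definition max_degree_le :: "nat \<Rightarrow> 'a set \<Rightarrow> 'a set set \<Rightarrow> bool" where
  "max_degree_le d V E \<longleftrightarrow> (\<forall>v\<in>V. card {e\<in>E. v \<in> e} \<le> d)"

lemma graph_finite_edges: "graph V E \<Longrightarrow> finite E"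
  unfolding graph_def by (auto intro: finite_subset[of E "Pow V"])

lemma graph_edgeE:
  assumes "graph V E" "e \<in> E"
  obtains a b where "e = {a, b}" "a \<noteq> b" "a \<in> V" "b \<in> V"
proof -
  have "e \<subseteq> V" "card e = 2" using assms by (auto simp: graph_def)
  then show ?thesis using that by (auto simp: card_2_iff)
qed

text \<open>Number the edges and give each vertex the number of the only edge through it: this one
  key is constant on every edge and differs between edges. On vertices in no edge \<open>THE\<close>
  is unspecified, but such vertices are never compared.\<close>

lemma sep_family_matching:
  assumes gr: "graph V E" and "max_degree_le 1 V E"
  shows "sep_family E 1"
proof -
  have fin: "finite E" using gr by (rule graph_finite_edges)
  then obtain h :: "'a set \<Rightarrow> nat" where h: "inj_on h E"
    using finite_imp_inj_to_nat_seg by blast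
  have the: "(THE e'. e' \<in> E \<and> v \<in> e') = e" if "e \<in> E" "v \<in> e" for e v
  proof (rule the_equality)
    fix e' assume e': "e' \<in> E \<and> v \<in> e'"
    have "v \<in> V" using gr that unfolding graph_def by blast
    then have "card {e\<in>E. v \<in> e} \<le> Suc 0" using assms unfolding max_degree_le_def by simp
    then show "e' = e" using e' that fin by (subst (asm) card_le_Suc0_iff_eq) auto
  qed (use that in blast)
  define g where "g v = int (h (THE e. e \<in> E \<and> v \<in> e))" for v
  have "\<exists>g\<in>{g}. (\<forall>a\<in>e. \<forall>b\<in>f. g a < g b) \<or> (\<forall>a\<in>e. \<forall>b\<in>f. g b < g a)"
    if "e \<in> E" "f \<in> E" "e \<inter> f = {}" for e f
  proof -
    \<comment> \<open>Nonemptiness turns disjointness into \<open>e \<noteq> f\<close>, so that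
      injectivity of \<open>h\<close> applies.\<close>
    have "e \<noteq> {}" using gr that unfolding graph_def by fastforce
    then have "h e \<noteq> h f" using h that by (metis inf.idem inj_onD)
    then have "h e < h f \<or> h f < h e" by linarith
    then show ?thesis using the that by (auto simp: g_def)
  qed
  then show ?thesis unfolding sep_family_def by (intro exI[of _ "{g}"]) auto
qed

section \<open>Balanced colourings\<close>

text \<open>Rosenfeld's counting argument replaces the Lovasz local lemma: the number of balanced
  partial colourings grows by a factor of at least \<open>\<beta>\<close> with every newly coloured vertex.\<close>

definition balanced :: "'b set \<Rightarrow> ('b \<Rightarrow> 'a set) \<Rightarrow> nat \<Rightarrow> 'a set \<Rightarrow> ('a \<Rightarrow> nat) \<Rightarrow> bool" where
  "balanced U S t X c \<longleftrightarrow> (\<forall>u\<in>U. \<forall>i. card {w \<in> S u \<inter> X. c w = i} \<le> t)"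

text \<open>The extensional function space represents each colouring of \<open>X\<close> by exactly
  one function, so that \<open>card\<close> counts colourings.\<close>

definition bal_cols :: "'b set \<Rightarrow> ('b \<Rightarrow> 'a set) \<Rightarrow> nat \<Rightarrow> nat \<Rightarrow> 'a set \<Rightarrow> ('a \<Rightarrow> nat) set" where
  "bal_cols U S t r X = {c \<in> X \<rightarrow>\<^sub>E {..<r}. balanced U S t X c}"

lemma finite_bal_cols: "finite X \<Longrightarrow> finite (bal_cols U S t r X)"
  unfolding bal_cols_def by (simp add: finite_PiE)

lemma restrict_bal_cols:
  assumes "c \<in> bal_cols U S t r X" "Y \<subseteq> X" "finite X"
  shows "restrict c Y \<in> bal_cols U S t r Y"
proof -
  have "card {w \<in> S u \<inter> Y. restrict c Y w = i} \<le> t" if "u \<in> U" for u i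
  proof -
    have "card {w \<in> S u \<inter> Y. restrict c Y w = i} \<le> card {w \<in> S u \<inter> X. c w = i}"
      using assms by (intro card_mono) auto
    also have "\<dots> \<le> t" using assms that unfolding bal_cols_def balanced_def by blast
    finally show ?thesis .
  qed
  moreover have "restrict c Y \<in> Y \<rightarrow>\<^sub>E {..<r}"
    using assms unfolding bal_cols_def by auto
  ultimately show ?thesis unfolding bal_cols_def balanced_def by blast
qed

lemma card_ext_cols:
  assumes "finite X" "v \<notin> X"
  shows "card {c \<in> insert v X \<rightarrow>\<^sub>E {..<r}. restrict c X \<in> bal_cols U S t r X}
    = r * card (bal_cols U S t r X)"
proof -
  have "bij_betw (\<lambda>(i, c). c(v := i)) ({..<r} \<times> bal_cols U S t r X)
     {c \<in> insert v X \<rightarrow>\<^sub>E {..<r}. restrict c X \<in> bal_cols U S t r X}"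
  proof (rule bij_betwI[where g = "\<lambda>c. (c v, restrict c X)"], goal_cases)
    case 1
    have "restrict (c(v := i)) X = c" if "c \<in> bal_cols U S t r X" for c i
    proof -
      have "restrict (c(v := i)) X = restrict c X" using assms by (auto simp: restrict_def)
      also have "\<dots> = c" using that unfolding bal_cols_def by (auto simp: PiE_restrict)
      finally show ?thesis .
    qed
    then show ?case by (auto simp: bal_cols_def intro!: PiE_fun_upd)
  next
    case 2
    then show ?case by (auto simp: PiE_iff)
  next
    case (3 x)
    obtain i c where x: "x = (i, c)" by force
    have "restrict (c(v := i)) X = restrict c X" using assms by (auto simp: restrict_def)
    also have "\<dots> = c" using 3 x unfolding bal_cols_def by (auto simp: PiE_restrict)
    finally show ?case using x by simp
  next
    case (4 y)
    then show ?case by (auto simp: fun_eq_iff PiE_iff extensional_def)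
  qed
  from bij_betw_same_card[OF this] show ?thesis by (simp add: card_cartesian_product)
qed

text \<open>Growth is assumed only for sets between \<open>Z\<close> and
  \<open>Z \<union> T\<close>. This lets the lemma serve inside the induction for a single step,
  where growth is known for smaller sets only, and again for all of \<open>V\<close>.\<close>

lemma bal_cols_iterate:
  assumes "finite T" "\<And>v Y. v \<in> T \<Longrightarrow> v \<notin> Y \<Longrightarrow> Z \<subseteq> Y \<Longrightarrow> insert v Y \<subseteq> Z \<union> T
      \<Longrightarrow> \<beta> * real (card (bal_cols U S t r Y)) \<le> real (card (bal_cols U S t r (insert v Y)))"
    and "Z \<inter> T = {}" "\<beta> > 0"
  shows "\<beta> ^ card T * real (card (bal_cols U S t r Z)) \<le> real (card (bal_cols U S t r (Z \<union> T)))"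
  using assms
proof (induction T rule: finite_induct)
  case (insert x T)
  have "\<beta> ^ card T * real (card (bal_cols U S t r Z)) \<le> real (card (bal_cols U S t r (Z \<union> T)))"
    using insert.prems by (intro insert.IH) auto
  then have "\<beta> * (\<beta> ^ card T * real (card (bal_cols U S t r Z)))
      \<le> \<beta> * real (card (bal_cols U S t r (Z \<union> T)))"
    using insert.prems by (intro mult_left_mono) auto
  also have "\<dots> \<le> real (card (bal_cols U S t r (insert x (Z \<union> T))))"
    using insert by (intro insert.prems) auto
  finally show ?case using insert.hyps by (simp add: mult.assoc)
qed simp

text \<open>There are \<open>r * card (bal_cols U S t r X)\<close> ways to extend by a colour of
  \<open>v\<close>. In an unbalanced one, some \<open>S u\<close> containing \<open>v\<close> has
  exactly \<open>t\<close> further vertices in the colour of \<open>v\<close>. There are at most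
  \<open>Suc d * (d choose t)\<close> choices of \<open>u\<close> and these vertices. By induction
  each choice spoils at most a fraction \<open>1 / \<beta> ^ (t - 1)\<close> of
  \<open>card (bal_cols U S t r X)\<close>, and the condition on \<open>r\<close> leaves the factor
  \<open>\<beta>\<close>.\<close>

lemma bal_cols_step:
  fixes \<beta> :: real
  assumes finV: "finite V" and finU: "finite U" and finS: "\<And>u. u \<in> U \<Longrightarrow> finite (S u)"
    and cardS: "\<And>u. u \<in> U \<Longrightarrow> card (S u) \<le> Suc d"
    and cardU: "\<And>v. v \<in> V \<Longrightarrow> card {u\<in>U. v \<in> S u} \<le> Suc d"
    and t: "t \<ge> 1" and \<beta>: "\<beta> > 0"
    and r: "\<beta> + real (Suc d) * real (d choose t) / \<beta> ^ (t - 1) \<le> real r"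
    and X: "insert v X \<subseteq> V" "v \<notin> X"
  shows "\<beta> * real (card (bal_cols U S t r X)) \<le> real (card (bal_cols U S t r (insert v X)))"
  using X
proof (induction "card X" arbitrary: X v rule: less_induct)
  case less
  have finX: "finite X" using less.prems finV finite_subset by auto
  let ?B = "bal_cols U S t r"
  define Ext where "Ext = {c \<in> insert v X \<rightarrow>\<^sub>E {..<r}. restrict c X \<in> ?B X}"
  have finExt: "finite Ext" unfolding Ext_def using finX by (simp add: finite_PiE)
  have cardExt: "card Ext = r * card (?B X)"
    unfolding Ext_def using finX less.prems by (intro card_ext_cols)
  define Bad where "Bad T = {c \<in> Ext. \<forall>w\<in>T. c w = c v}" for T
  define \<T> where "\<T> u = {T. T \<subseteq> S u \<inter> X \<and> card T = t}" for u
  define W where "W = {u\<in>U. v \<in> S u}"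
  have finW: "finite W" using finU by (simp add: W_def)
  have fin\<T>: "finite (\<T> u)" for u
    unfolding \<T>_def using finX by (rule_tac finite_subset[of _ "Pow X"]) auto
  have card\<T>: "card (\<T> u) \<le> d choose t" if "u \<in> W" for u
  proof -
    have u: "u \<in> U" "v \<in> S u" using that by (auto simp: W_def)
    have "card (\<T> u) = card (S u \<inter> X) choose t"
      unfolding \<T>_def using finX by (subst n_subsets) auto
    \<comment> \<open>The vertex \<open>v\<close> lies in \<open>S u\<close> but not in
      \<open>X\<close>, which leaves \<open>d\<close> candidates instead of
      \<open>d + 1\<close>.\<close>
    also have "card (S u \<inter> X) \<le> card (S u - {v})"
      using finS u less.prems by (intro card_mono) auto
    also have "\<dots> \<le> d" using cardS[of u] finS u by simp
    finally show ?thesis by (simp add: binomial_right_mono)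
  qed
  have cardBad: "real (card (Bad T)) \<le> real (card (?B X)) / \<beta> ^ (t - 1)" if T: "T \<in> \<T> u" for T u
  proof -
    have TX: "T \<subseteq> X" and ct: "card T = t" using T by (auto simp: \<T>_def)
    have finT: "finite T" using TX finX finite_subset by blast
    have "T \<noteq> {}" using ct t by auto
    then obtain w where w: "w \<in> T" by blast
    \<comment> \<open>Erase the colours of \<open>v\<close> and of \<open>T\<close> except at
      \<open>w\<close>. Since \<open>w\<close> still shows their common colour, nothing is lost.
      Restoring the \<open>t - 1\<close> vertices of \<open>T - {w}\<close> goes through sets
      smaller than \<open>X\<close>, where the induction hypothesis gives a factor
      \<open>\<beta>\<close> each.\<close>
    define Z where "Z = X - (T - {w})"
    have "inj_on (\<lambda>c. restrict c Z) (Bad T)"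
    proof (rule inj_onI)
      fix c c' assume c: "c \<in> Bad T" "c' \<in> Bad T" and eq: "restrict c Z = restrict c' Z"
      have on: "c x = c' x" if "x \<in> Z" for x using fun_cong[OF eq, of x] that by simp
      have cw: "c w = c' w" using on[of w] w TX by (auto simp: Z_def)
      have "c x = c' x" if "x \<in> insert v T" for x
        using that c cw w unfolding Bad_def by (cases "x = v") auto
      then have "c x = c' x" if "x \<in> insert v X" for x using on that unfolding Z_def by blast
      moreover have "c \<in> extensional (insert v X)" "c' \<in> extensional (insert v X)"
        using c unfolding Bad_def Ext_def PiE_def by auto
      ultimately show "c = c'" by (intro extensionalityI) auto
    qed
    moreover have "(\<lambda>c. restrict c Z) ` Bad T \<subseteq> ?B Z"
    proof
      fix y assume "y \<in> (\<lambda>c. restrict c Z) ` Bad T"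
      then obtain c where c: "c \<in> Bad T" "y = restrict c Z" by blast
      have "restrict (restrict c X) Z \<in> ?B Z"
        using c finX unfolding Bad_def Ext_def Z_def by (intro restrict_bal_cols) auto
      moreover have "restrict (restrict c X) Z = restrict c Z"
        unfolding Z_def by (auto simp: restrict_def fun_eq_iff)
      ultimately show "y \<in> ?B Z" using c by simp
    qed
    ultimately have "card (Bad T) \<le> card (?B Z)"
      using finX by (intro card_inj_on_le) (auto simp: Z_def finite_bal_cols)
    moreover have "\<beta> ^ (t - 1) * real (card (?B Z)) \<le> real (card (?B X))"
    proof -
      have ZT: "Z \<union> (T - {w}) = X" using TX by (auto simp: Z_def)
      have "\<beta> ^ card (T - {w}) * real (card (?B Z)) \<le> real (card (?B (Z \<union> (T - {w}))))"
      proof (rule bal_cols_iterate)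
        fix x Y assume x: "x \<in> T - {w}" "x \<notin> Y" "Z \<subseteq> Y" "insert x Y \<subseteq> Z \<union> (T - {w})"
        then have sub: "insert x Y \<subseteq> X" using ZT by auto
        then have "card Y < card X" using x finX by (intro psubset_card_mono) auto
        then show "\<beta> * real (card (?B Y)) \<le> real (card (?B (insert x Y)))"
          using sub x less.prems by (intro less.hyps) auto
      qed (use finT \<beta> in \<open>auto simp: Z_def\<close>)
      then show ?thesis using ZT w ct finT by simp
    qed
    ultimately have "\<beta> ^ (t - 1) * real (card (Bad T)) \<le> real (card (?B X))"
      using \<beta> by (meson of_nat_mono mult_left_mono order_trans zero_le_power less_imp_le)
    then show ?thesis using \<beta> by (simp add: field_simps)
  qed
  have cover: "Ext \<subseteq> ?B (insert v X) \<union> (\<Union>u\<in>W. \<Union>T\<in>\<T> u. Bad T)"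
  proof
    fix c assume c: "c \<in> Ext"
    show "c \<in> ?B (insert v X) \<union> (\<Union>u\<in>W. \<Union>T\<in>\<T> u. Bad T)"
    proof (cases "balanced U S t (insert v X) c")
      case True
      then show ?thesis using c unfolding Ext_def bal_cols_def by blast
    next
      case False
      then obtain u i where u: "u \<in> U" and gt: "t < card {w \<in> S u \<inter> insert v X. c w = i}"
        unfolding balanced_def by (auto simp: not_le)
      \<comment> \<open>On \<open>X\<close> the colouring is balanced, so the overflow in colour
        \<open>i\<close> must come from \<open>v\<close>, and \<open>T\<close> has exactly
        \<open>t\<close> elements.\<close>
      define T where "T = {w \<in> S u \<inter> X. c w = i}"
      have "T = {w \<in> S u \<inter> X. restrict c X w = i}" by (auto simp: T_def)
      then have le: "card T \<le> t"
        using c u unfolding Ext_def bal_cols_def balanced_def by auto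
      have finT: "finite T" using finX by (simp add: T_def)
      have v: "v \<in> S u \<and> c v = i"
      proof (rule ccontr)
        assume "\<not> (v \<in> S u \<and> c v = i)"
        then have "{w \<in> S u \<inter> insert v X. c w = i} = T" by (auto simp: T_def)
        then show False using gt le by simp
      qed
      then have "{w \<in> S u \<inter> insert v X. c w = i} = insert v T" by (auto simp: T_def)
      then have "t < Suc (card T)" using gt finT by (simp add: card_insert_if split: if_splits)
      then have "T \<in> \<T> u" using le by (auto simp: \<T>_def T_def)
      moreover have "c \<in> Bad T" using c v by (auto simp: Bad_def T_def)
      moreover have "u \<in> W" using u v by (simp add: W_def)
      ultimately show ?thesis by blast
    qed
  qed
  have finBad: "finite (Bad T)" for T using finExt by (simp add: Bad_def)
  have fin: "finite (?B (insert v X))" using finX by (simp add: finite_bal_cols)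
  have "card Ext \<le> card (?B (insert v X) \<union> (\<Union>u\<in>W. \<Union>T\<in>\<T> u. Bad T))"
    using cover fin finW fin\<T> finBad by (intro card_mono) auto
  also have "\<dots> \<le> card (?B (insert v X)) + card (\<Union>u\<in>W. \<Union>T\<in>\<T> u. Bad T)"
    by (rule card_Un_le)
  also have "card (\<Union>u\<in>W. \<Union>T\<in>\<T> u. Bad T) \<le> (\<Sum>u\<in>W. card (\<Union>T\<in>\<T> u. Bad T))"
    using finW by (rule card_UN_le)
  also have "(\<Sum>u\<in>W. card (\<Union>T\<in>\<T> u. Bad T)) \<le> (\<Sum>u\<in>W. \<Sum>T\<in>\<T> u. card (Bad T))"
    using fin\<T> by (intro sum_mono card_UN_le)
  finally have "real (card Ext) \<le>
      real (card (?B (insert v X))) + (\<Sum>u\<in>W. \<Sum>T\<in>\<T> u. real (card (Bad T)))"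
    unfolding of_nat_sum[symmetric] of_nat_add[symmetric] of_nat_le_iff by simp
  also have "(\<Sum>u\<in>W. \<Sum>T\<in>\<T> u. real (card (Bad T)))
      \<le> real (Suc d) * real (d choose t) * (real (card (?B X)) / \<beta> ^ (t - 1))"
  proof -
    let ?q = "real (card (?B X)) / \<beta> ^ (t - 1)"
    have q: "?q \<ge> 0" using \<beta> by simp
    have "(\<Sum>T\<in>\<T> u. real (card (Bad T))) \<le> real (d choose t) * ?q" if "u \<in> W" for u
    proof -
      have "(\<Sum>T\<in>\<T> u. real (card (Bad T))) \<le> real (card (\<T> u)) * ?q"
        using cardBad by (rule sum_bounded_above)
      also have "\<dots> \<le> real (d choose t) * ?q"
        using card\<T>[OF that] q by (intro mult_right_mono) auto
      finally show ?thesis .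
    qed
    then have "(\<Sum>u\<in>W. \<Sum>T\<in>\<T> u. real (card (Bad T))) \<le> real (card W) * (real (d choose t) * ?q)"
      by (rule sum_bounded_above)
    also have "\<dots> \<le> real (Suc d) * (real (d choose t) * ?q)"
      using cardU[of v] less.prems unfolding W_def
      by (intro mult_right_mono mult_nonneg_nonneg q) (auto simp del: of_nat_Suc)
    finally show ?thesis by (simp only: mult.assoc)
  qed
  finally have 1: "real r * real (card (?B X)) \<le> real (card (?B (insert v X)))
      + real (Suc d) * real (d choose t) / \<beta> ^ (t - 1) * real (card (?B X))"
    unfolding cardExt by simp
  have "(\<beta> + real (Suc d) * real (d choose t) / \<beta> ^ (t - 1)) * real (card (?B X))
      \<le> real r * real (card (?B X))"
    using r by (rule mult_right_mono) simp
  then show ?case using 1 by (simp only: distrib_right)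
qed

text \<open>The empty colouring is balanced, and multiplying the count by at least
  \<open>\<beta> > 0\<close> at each vertex keeps it positive.\<close>

lemma balanced_colouring_exists:
  fixes \<beta> :: real
  assumes "finite V" "finite U" "\<And>u. u \<in> U \<Longrightarrow> finite (S u)"
    and "\<And>u. u \<in> U \<Longrightarrow> card (S u) \<le> Suc d"
    and "\<And>v. v \<in> V \<Longrightarrow> card {u\<in>U. v \<in> S u} \<le> Suc d"
    and "t \<ge> 1" "\<beta> > 0"
    and "\<beta> + real (Suc d) * real (d choose t) / \<beta> ^ (t - 1) \<le> real r"
  obtains c where "\<And>v. v \<in> V \<Longrightarrow> c v < r" "balanced U S t V c"
proof -
  have "(\<lambda>_. undefined) \<in> bal_cols U S t r {}" by (simp add: bal_cols_def balanced_def)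
  then have "0 < card (bal_cols U S t r {})" by (auto simp: card_gt_0_iff finite_bal_cols)
  then have "0 < \<beta> ^ card V * real (card (bal_cols U S t r {}))" using assms by simp
  also have "\<dots> \<le> real (card (bal_cols U S t r ({} \<union> V)))"
    using assms by (intro bal_cols_iterate bal_cols_step) auto
  finally obtain c where "c \<in> bal_cols U S t r V" by (auto simp: card_gt_0_iff)
  then show ?thesis by (intro that[of c]) (auto simp: bal_cols_def)
qed

section \<open>The iterated logarithm and the parameters of the recursion\<close>

text \<open>Makes the \<open>LEAST\<close> in \<open>logstar\<close> meaningful. Induction on an
  integer upper bound works because \<open>Suc n \<le> 2 ^ n\<close>: one logarithm lowers the bound
  from \<open>Suc n\<close> to \<open>n\<close>.\<close>

lemma logstar_ex: "\<exists>k. (log 2 ^^ k) x \<le> 1"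
proof -
  have "x \<le> real n \<Longrightarrow> \<exists>k. (log 2 ^^ k) x \<le> 1" for n
  proof (induction n arbitrary: x)
    case 0
    then show ?case by (intro exI[of _ 0]) simp
  next
    case (Suc n)
    show ?case
    proof (cases "x \<le> 1")
      case True
      then show ?thesis by (intro exI[of _ 0]) simp
    next
      case False
      have "Suc n \<le> 2 ^ n" by (simp add: Suc_leI)
      then have "real (Suc n) \<le> 2 ^ n"
        by (metis of_nat_le_iff of_nat_numeral of_nat_power)
      then have "x \<le> 2 powr real n" using Suc.prems by (simp add: powr_realpow)
      then have "log 2 x \<le> real n" using False by (simp add: log_le_iff)
      then obtain k where "(log 2 ^^ k) (log 2 x) \<le> 1" using Suc.IH by blast
      then show ?thesis by (intro exI[of _ "Suc k"]) (simp add: funpow_Suc_right del: funpow.simps)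
    qed
  qed
  then show ?thesis using real_arch_simple by blast
qed

lemma logstar_eq_0: "x \<le> 1 \<Longrightarrow> logstar x = 0"
  unfolding logstar_def by (rule Least_eq_0) simp

lemma logstar_rec:
  assumes "x > 1"
  shows "logstar x = Suc (logstar (log 2 x))"
proof -
  obtain k where "(log 2 ^^ k) x \<le> 1" using logstar_ex by blast
  then have "(LEAST k. (log 2 ^^ k) x \<le> 1) = Suc (LEAST k. (log 2 ^^ Suc k) x \<le> 1)"
    by (rule Least_Suc) (use assms in simp)
  then show ?thesis unfolding logstar_def by (simp add: funpow_Suc_right del: funpow.simps)
qed

lemma logstar_mono: "x \<le> y \<Longrightarrow> logstar x \<le> logstar y"
proof (induction "logstar y" arbitrary: x y rule: less_induct)
  case less
  show ?case
  proof (cases "x \<le> 1")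
    case False
    then have "log 2 x \<le> log 2 y" using less.prems by simp
    then have "logstar (log 2 x) \<le> logstar (log 2 y)"
      using False less by (intro less.hyps) (auto simp: logstar_rec)
    then show ?thesis using False less.prems by (simp add: logstar_rec)
  qed (simp add: logstar_eq_0)
qed

text \<open>A single term of the exponential series gives t^t / t! \<le> e^t \<le> 4^t, which is
  combined with (d choose t) \<le> d^t / t!.\<close>

lemma binomial_bound:
  assumes "t \<ge> 1"
  shows "real (d choose t) \<le> (4 * real d / real t) ^ t"
proof -
  have "(\<Sum>n\<in>{t}. inverse (fact n) * real t ^ n) \<le> (\<Sum>n. inverse (fact n) * real t ^ n)"
    using summable_exp[of "real t"] by (intro sum_le_suminf) auto
  then have "real t ^ t / fact t \<le> exp (real t)" by (simp add: exp_def field_simps)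
  also have "exp (real t) = exp 1 ^ t" by (metis exp_of_nat_mult mult.right_neutral)
  also have "\<dots> \<le> 4 ^ t" using exp_le by (intro power_mono) auto
  finally have f: "real t ^ t \<le> 4 ^ t * fact t" by (simp add: field_simps)
  have "(d choose t) * fact t \<le> d ^ t" by (rule binomial_fact_pow)
  then have "real (d choose t) * fact t \<le> real d ^ t"
    by (metis of_nat_fact of_nat_le_iff of_nat_mult of_nat_power)
  then have le: "4 ^ t * (real (d choose t) * fact t) \<le> 4 ^ t * real d ^ t"
    by (rule mult_left_mono) simp
  have "real (d choose t) * real t ^ t \<le> real (d choose t) * (4 ^ t * fact t)"
    using f by (rule mult_left_mono) simp
  also have "\<dots> = 4 ^ t * (real (d choose t) * fact t)" by simp
  also note le
  finally have "real (d choose t) * real t ^ t \<le> 4 ^ t * real d ^ t" .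
  then show ?thesis using assms by (simp add: power_divide power_mult_distrib field_simps)
qed

text \<open>The factor 512 is the budget that one step of log* grants to the recursion.\<close>

lemma powr_9_Suc: "2 powr (9 * real (Suc k)) = 512 * 2 powr (9 * real k)"
  by (simp add: distrib_left powr_add)

lemma recursion_parameters:
  assumes d: "d \<ge> 4"
  obtains t r :: nat and \<beta> :: real where "t \<ge> 1" "\<beta> > 0" "r \<ge> 1" "2 * t - 1 < d"
    "\<beta> + real (Suc d) * real (d choose t) / \<beta> ^ (t - 1) \<le> real r"
    "real r * (2 powr (9 * real (logstar (real (2 * t - 1)))) * real (2 * t - 1)) + 4 * real r
       \<le> 2 powr (9 * real (logstar (real d))) * real d"
proof -
  \<comment> \<open>Half the logarithm makes the new degree \<open>2 * t - 1\<close> less than log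
    d, so log* drops by at least one. Rounding down is cheap: log d < 2 (t + 1) \<le> 4 t, hence d <
    16^t.\<close>
  define t where "t = nat \<lfloor>log 2 (real d) / 2\<rfloor>"
  have "log 2 4 \<le> log 2 (real d)" using d by (subst log_le_cancel_iff) auto
  moreover have "log 2 4 = (2::real)" using log_pow_cancel[of 2 2] by simp
  ultimately have l2: "log 2 (real d) \<ge> 2" by simp
  then have t: "t \<ge> 1" unfolding t_def by linarith
  have tl: "2 * real t \<le> log 2 (real d)" unfolding t_def using l2 by linarith
  have "log 2 (real d) / 2 < real t + 1" unfolding t_def using l2 by linarith
  then have "log 2 (real d) < real (2 * (t + 1))" by simp
  also have "\<dots> \<le> real (4 * t)" using t by simp
  finally have "real d < 2 powr real (4 * t)" using d by (subst (asm) log_less_iff) auto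
  also have "2 powr real (4 * t) = 2 ^ (4 * t)" by (rule powr_realpow) simp
  also have "\<dots> = 16 ^ t" by (simp add: power_mult)
  finally have "d < 16 ^ t" by (metis of_nat_less_iff of_nat_numeral of_nat_power)
  then have d16: "real (Suc d) \<le> 16 ^ t" by (metis Suc_leI of_nat_le_iff of_nat_numeral of_nat_power)
  have "d < 2 ^ d" by simp
  then have "real d < 2 powr real d" by (simp add: powr_realpow)
  then have ld: "log 2 (real d) < real d" using d by (subst log_less_iff) auto
  \<comment> \<open>The constant is 16 * 4: the bounds 16^t for d + 1 and (4 d / t)^t for the
    binomial multiply to \<open>\<beta> ^ t\<close>. The second summand of the counting condition is
    then at most \<open>\<beta>\<close>, so \<open>r\<close> may be \<open>2 * \<beta>\<close>
    rounded up.\<close>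
  define \<beta> where "\<beta> = 64 * real d / real t"
  define r where "r = nat \<lceil>2 * \<beta>\<rceil>"
  have \<beta>: "\<beta> > 0" using d t by (simp add: \<beta>_def)
  have r1: "2 * \<beta> \<le> real r" unfolding r_def using \<beta> by linarith
  have r2: "real r \<le> 2 * \<beta> + 1" unfolding r_def using \<beta> by linarith
  have "real (Suc d) * real (d choose t) \<le> 16 ^ t * (4 * real d / real t) ^ t"
    using d16 binomial_bound[OF t] by (intro mult_mono) auto
  also have "\<dots> = \<beta> ^ t" unfolding power_mult_distrib[symmetric] by (simp add: \<beta>_def)
  also have "\<dots> = \<beta> * \<beta> ^ (t - 1)" using t by (metis One_nat_def Suc_diff_1 Suc_le_lessD power_Suc)
  finally have "real (Suc d) * real (d choose t) / \<beta> ^ (t - 1) \<le> \<beta>"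
    using \<beta> by (simp add: divide_le_eq)
  then have main: "\<beta> + real (Suc d) * real (d choose t) / \<beta> ^ (t - 1) \<le> real r" using r1 by linarith
  define M where "M = 2 powr (9 * real (logstar (log 2 (real d))))"
  have ls: "2 powr (9 * real (logstar (real d))) = 512 * M"
    unfolding M_def using logstar_rec[of "real d"] d powr_9_Suc by simp
  \<comment> \<open>As log d \<ge> 2, a second step of log* is available. It gives
    \<open>M \<ge> 512\<close>, so that \<open>M * d\<close> absorbs the \<open>512 * d\<close>
    arising from \<open>4 * r\<close>.\<close>
  have "logstar (log 2 (real d)) = Suc (logstar (log 2 (log 2 (real d))))"
    using l2 by (intro logstar_rec) simp
  then have "M = 512 * 2 powr (9 * real (logstar (log 2 (log 2 (real d)))))"
    unfolding M_def by (simp only: powr_9_Suc)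
  moreover have "2 powr (9 * real (logstar (log 2 (log 2 (real d))))) \<ge> 1"
    by (intro ge_one_powr_ge_zero) auto
  ultimately have M: "M \<ge> 512" by linarith
  have rt: "real (2 * t - 1) \<le> 2 * real t" by simp
  have "logstar (real (2 * t - 1)) \<le> logstar (log 2 (real d))"
    using rt tl by (intro logstar_mono) linarith
  then have M2: "2 powr (9 * real (logstar (real (2 * t - 1)))) \<le> M" unfolding M_def by simp
  have "\<beta> \<le> 64 * real d" using t d by (simp add: \<beta>_def divide_le_eq)
  then have r4: "4 * real r \<le> 512 * real d + 4" using r2 by simp
  have "real r * (2 powr (9 * real (logstar (real (2 * t - 1)))) * real (2 * t - 1))
      \<le> (2 * \<beta> + 1) * (M * (2 * real t))"
    using r2 M2 rt M \<beta> by (intro mult_mono) auto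
  also have "\<dots> = M * (256 * real d + 2 * real t)" using t by (simp add: \<beta>_def field_simps)
  also have "\<dots> \<le> M * (257 * real d)" using M tl ld by (intro mult_left_mono) auto
  finally have "real r * (2 powr (9 * real (logstar (real (2 * t - 1)))) * real (2 * t - 1))
      \<le> 257 * (M * real d)" by simp
  moreover have "512 * real d \<le> M * real d" using M by (intro mult_right_mono) auto
  \<comment> \<open>Of the 512 multiples of \<open>M * d\<close>, the recursive term takes 257, and
    \<open>4 * r\<close> takes at most one more, plus 4.\<close>
  ultimately have "real r * (2 powr (9 * real (logstar (real (2 * t - 1)))) * real (2 * t - 1)) + 4 * real r
      \<le> 512 * M * real d" using r4 d by linarith
  moreover have "r \<ge> 1" using r1 \<beta> by linarith
  moreover have "2 * t - 1 < d" using tl ld t by linarith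
  ultimately show ?thesis using t \<beta> main ls by (intro that[of t \<beta> r]) auto
qed

section \<open>Reduction to smaller maximum degree\<close>

text \<open>Monochromatic edges belong to every class, so such an edge shares a class with any other
  edge.\<close>

definition colour_class :: "'a set set \<Rightarrow> ('a \<Rightarrow> nat) \<Rightarrow> nat \<Rightarrow> nat \<Rightarrow> 'a set set" where
  "colour_class E c r s = {e\<in>E. \<exists>x y. e = {x, y} \<and> (c x = c y \<or> (c x + c y) mod r = s)}"

text \<open>For a fixed residue \<open>s\<close>, the relation \<open>i + j \<equiv> s\<close> (mod \<open>r\<close>) pairs every colour \<open>i\<close>
  with exactly one colour \<open>j\<close>, so a vertex keeps only its neighbours in two colours. The closed
  neighbourhood contains the vertex itself, whence the saving of one.\<close>

lemma max_degree_colour_class: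
  assumes gr: "graph V E" and c: "\<And>v. v \<in> V \<Longrightarrow> c v < r"
    and bal: "balanced V (\<lambda>v. {w\<in>V. w = v \<or> {v, w} \<in> E}) t V c"
  shows "max_degree_le (2 * t - 1) V (colour_class E c r s)"
  unfolding max_degree_le_def
proof
  fix v assume v: "v \<in> V"
  let ?N = "{w\<in>V. w = v \<or> {v, w} \<in> E}"
  have finV: "finite V" using gr by (simp add: graph_def)
  have le: "card {w \<in> ?N. c w = i} \<le> t" for i
  proof -
    have "\<forall>i. card {w \<in> ?N \<inter> V. c w = i} \<le> t"
      using bal[unfolded balanced_def] v by (rule bspec)
    then have "card {w \<in> ?N \<inter> V. c w = i} \<le> t" by (rule spec)
    moreover have "{w \<in> ?N \<inter> V. c w = i} = {w \<in> ?N. c w = i}" by auto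
    ultimately show ?thesis by (simp only:)
  qed
  define A where "A = {w \<in> ?N. c w = c v} - {v}"
  define B where "B = {w \<in> ?N. (c v + c w) mod r = s}"
  have "card A = card {w \<in> ?N. c w = c v} - 1"
    unfolding A_def by (rule card_Diff_singleton) (use v in simp)
  then have "card A \<le> t - 1" using le[of "c v"] by linarith
  moreover have "t > 0"
  proof -
    have "v \<in> {w \<in> ?N. c w = c v}" using v by simp
    then have "0 < card {w \<in> ?N. c w = c v}" using finV by (subst card_gt_0_iff) auto
    then show ?thesis using le[of "c v"] by linarith
  qed
  moreover have "card B \<le> t"
  proof (cases "B = {}")
    case False
    then obtain w0 where w0: "w0 \<in> B" by blast
    have "c w = c w0" if "w \<in> B" for w
    proof -
      have "(c v + c w) mod r = (c v + c w0) mod r" using that w0 by (simp add: B_def)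
      \<comment> \<open>Over the integers \<open>c v\<close> cancels modulo \<open>r\<close>, and
        colours below \<open>r\<close> that are congruent are equal.\<close>
      then have "int ((c v + c w) mod r) = int ((c v + c w0) mod r)" by (rule arg_cong)
      then have "(int (c v) + int (c w)) mod int r = (int (c v) + int (c w0)) mod int r"
        by (simp only: zmod_int of_nat_add)
      then have "int (c w) mod int r = int (c w0) mod int r"
        by (simp add: mod_eq_dvd_iff)
      then show ?thesis using c[of w] c[of w0] that w0 by (simp add: B_def)
    qed
    then have "B \<subseteq> {w \<in> ?N. c w = c w0}" by (auto simp: B_def)
    then have "card B \<le> card {w \<in> ?N. c w = c w0}" using finV by (intro card_mono) auto
    then show ?thesis using le[of "c w0"] by linarith
  qed simp
  moreover have sub: "{e \<in> colour_class E c r s. v \<in> e} \<subseteq> (\<lambda>w. {v, w}) ` (A \<union> B)"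
  proof
    fix e assume "e \<in> {e \<in> colour_class E c r s. v \<in> e}"
    then obtain x y where e: "e \<in> E" "v \<in> e" "e = {x, y}" "c x = c y \<or> (c x + c y) mod r = s"
      unfolding colour_class_def by blast
    have "e \<subseteq> V" "card e = 2" using e(1) gr by (auto simp: graph_def)
    then have ne: "x \<noteq> y" "x \<in> V" "y \<in> V" using e(3) by auto
    obtain w where w: "e = {v, w}" "w \<noteq> v" "w \<in> V" "c w = c v \<or> (c v + c w) mod r = s"
    proof (cases "v = x")
      case True
      then show ?thesis using e(3,4) ne by (intro that[of y]) auto
    next
      case False
      then have "v = y" using e(2,3) by blast
      then show ?thesis using e(3,4) ne
        by (intro that[of x]) (auto simp: add.commute)
    qed
    then have "w \<in> A \<union> B" using e(1) by (auto simp: A_def B_def)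
    then show "e \<in> (\<lambda>w. {v, w}) ` (A \<union> B)" using w by blast
  qed
  moreover have "card {e \<in> colour_class E c r s. v \<in> e} \<le> card (A \<union> B)"
    by (rule surj_card_le[OF _ sub]) (use finV in \<open>simp add: A_def B_def\<close>)
  moreover have "card (A \<union> B) \<le> card A + card B" by (rule card_Un_le)
  ultimately show "card {e \<in> colour_class E c r s. v \<in> e} \<le> 2 * t - 1" by linarith
qed

section \<open>Separating edges by moving one colour block\<close>

text \<open>Moving block \<open>s\<close> to the front (key \<open>-1\<close>) or to the end (key \<open>r\<close>) separates edges using at
  least three colours; the direction inside the blocks decides when the edges share a colour.\<close>

definition block_key ::
  "('a \<Rightarrow> nat) \<Rightarrow> ('a \<Rightarrow> nat) \<Rightarrow> nat \<Rightarrow> nat \<Rightarrow> nat \<times> bool \<times> bool \<Rightarrow> 'a \<Rightarrow> int" where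
  "block_key c lab N r = (\<lambda>(s, front, up) v.
     (if c v = s then (if front then -1 else int r) else int (c v)) * int N
     + (if up then int (lab v) else - int (lab v)))"

text \<open>Labels below \<open>N\<close> differ by less than \<open>N\<close>, so a gap of one
  block outweighs them and the keys compare lexicographically.\<close>

lemma lex_key_less:
  fixes p q x y :: int
  assumes "p < q" "\<bar>x - y\<bar> < int N"
  shows "p * int N + x < q * int N + y"
proof -
  have "(p + 1) * int N \<le> q * int N" using assms by (intro mult_right_mono) auto
  then show ?thesis using assms by (simp add: distrib_right)
qed

lemma block_key_less:
  assumes "lab v < N" "lab w < N"
    and "(if c v = s then (if front then -1 else int r) else int (c v))
        < (if c w = s then (if front then -1 else int r) else int (c w))"
  shows "block_key c lab N r (s, front, up) v < block_key c lab N r (s, front, up) w"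
proof -
  have "\<bar>(if up then int (lab v) else - int (lab v)) - (if up then int (lab w) else - int (lab w))\<bar>
      < int N"
    using assms(1,2) by auto
  from lex_key_less[OF assms(3) this] show ?thesis by (simp only: block_key_def prod.case)
qed

text \<open>Once the block of \<open>y\<close> is in front, \<open>y\<close> precedes
  \<open>z\<close> and \<open>w\<close>; so does \<open>x\<close>, whose colour is minimal and
  differs from theirs.\<close>

lemma block_key_separates_disjoint:
  assumes lab: "\<And>v. v \<in> {x, y, z, w} \<Longrightarrow> lab v < N"
    and min: "c x \<le> c y" "c x \<le> c z" "c x \<le> c w"
    and ne: "c x \<noteq> c z" "c x \<noteq> c w" "c y \<noteq> c z" "c y \<noteq> c w"
  shows "\<forall>a\<in>{x, y}. \<forall>b\<in>{z, w}.
    block_key c lab N r (c y, True, True) a < block_key c lab N r (c y, True, True) b"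
proof (intro ballI)
  fix a b assume "a \<in> {x, y}" "b \<in> {z, w}"
  then have ab: "a = x \<or> a = y" "b = z \<or> b = w" by auto
  show "block_key c lab N r (c y, True, True) a < block_key c lab N r (c y, True, True) b"
  proof (rule block_key_less)
    have "c b \<noteq> c y" using ab(2) ne by auto
    moreover have "c x < c b" using ab(2) ne min by auto
    then have "c a = c y \<or> c a < c b" using ab(1) by auto
    ultimately show "(if c a = c y then if True then - 1 else int r else int (c a))
        < (if c b = c y then if True then - 1 else int r else int (c b))" by auto
  qed (use lab ab in auto)
qed

text \<open>Moving the block of \<open>x\<close> leaves the other three vertices in place. If the
  shared block lies before that of \<open>w\<close>, put \<open>x\<close> first and let
  \<open>y\<close> precede \<open>z\<close> inside the block. Otherwise reverse everything:
  \<open>x\<close> last and \<open>z\<close> before \<open>y\<close>. The labels of \<open>y\<close>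
  and \<open>z\<close> dictate the direction \<open>up\<close>.\<close>

lemma block_key_separates_shared:
  assumes lab: "\<And>v. v \<in> {x, y, z, w} \<Longrightarrow> lab v < N"
    and r: "c x < r" "c y < r" "c z < r" "c w < r"
    and sh: "c y = c z" "c x \<noteq> c y" "c w \<noteq> c y" "c x \<noteq> c w" "lab y \<noteq> lab z"
  shows "\<exists>front up.
    (\<forall>a\<in>{x, y}. \<forall>b\<in>{z, w}.
      block_key c lab N r (c x, front, up) a < block_key c lab N r (c x, front, up) b) \<or>
    (\<forall>a\<in>{x, y}. \<forall>b\<in>{z, w}.
      block_key c lab N r (c x, front, up) b < block_key c lab N r (c x, front, up) a)"
proof (cases "c y < c w")
  case True
  have "block_key c lab N r (c x, True, lab y < lab z) y
      < block_key c lab N r (c x, True, lab y < lab z) z"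
    using sh by (auto simp: block_key_def)
  moreover have "block_key c lab N r (c x, True, lab y < lab z) y
      < block_key c lab N r (c x, True, lab y < lab z) w"
    by (rule block_key_less) (use lab sh True in auto)
  moreover have "block_key c lab N r (c x, True, lab y < lab z) x
      < block_key c lab N r (c x, True, lab y < lab z) b" if "b = z \<or> b = w" for b
  proof (rule block_key_less)
    have "c b \<noteq> c x" using that sh by auto
    then show "(if c x = c x then if True then - 1 else int r else int (c x))
        < (if c b = c x then if True then - 1 else int r else int (c b))" by simp
  qed (use lab that in auto)
  ultimately have "\<forall>a\<in>{x, y}. \<forall>b\<in>{z, w}. block_key c lab N r (c x, True, lab y < lab z) a
      < block_key c lab N r (c x, True, lab y < lab z) b"
    by simp
  then show ?thesis by (intro exI[of _ True] exI[of _ "lab y < lab z"] disjI1)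
next
  case False
  have "block_key c lab N r (c x, False, lab z < lab y) z
      < block_key c lab N r (c x, False, lab z < lab y) y"
    using sh by (auto simp: block_key_def)
  moreover have "block_key c lab N r (c x, False, lab z < lab y) w
      < block_key c lab N r (c x, False, lab z < lab y) y"
    by (rule block_key_less) (use lab sh False in auto)
  moreover have "block_key c lab N r (c x, False, lab z < lab y) b
      < block_key c lab N r (c x, False, lab z < lab y) x" if "b = z \<or> b = w" for b
  proof (rule block_key_less)
    have "c b \<noteq> c x" "c b < r" using that sh r by auto
    then show "(if c b = c x then if False then - 1 else int r else int (c b))
        < (if c x = c x then if False then - 1 else int r else int (c x))" by simp
  qed (use lab that in auto)
  ultimately have "\<forall>a\<in>{x, y}. \<forall>b\<in>{z, w}. block_key c lab N r (c x, False, lab z < lab y) b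
      < block_key c lab N r (c x, False, lab z < lab y) a"
    by simp
  then show ?thesis by (intro exI[of _ False] exI[of _ "lab z < lab y"] disjI2)
qed

text \<open>Two bichromatic edges with different colour pairs share at most one colour. The case
  \<open>same\<close> is left to the colour classes, the other two to the block keys.\<close>

lemma colour_pairs_cases:
  fixes c :: "'a \<Rightarrow> nat"
  obtains (same) "c x = c y \<or> c z = c w \<or> {c x, c y} = {c z, c w}"
  | (disj) "c ` {x, y} \<inter> c ` {z, w} = {}"
  | (shared) x' y' z' w' where "{x', y'} = {x, y}" "{z', w'} = {z, w}"
      "c y' = c z'" "c x' \<noteq> c y'" "c w' \<noteq> c y'" "c x' \<noteq> c w'"
proof (cases "c x = c y \<or> c z = c w \<or> {c x, c y} = {c z, c w}")
  case True
  then show ?thesis by (rule same)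
next
  case ne: False
  show ?thesis
  proof (cases "c ` {x, y} \<inter> c ` {z, w} = {}")
    case True
    then show ?thesis by (rule disj)
  next
    case False
    then consider "c y = c z" | "c y = c w" | "c x = c z" | "c x = c w" by auto
    then show ?thesis
    proof cases
      case 1
      then show ?thesis using ne by (intro shared[of x y z w]) auto
    next
      case 2
      then show ?thesis using ne by (intro shared[of x y w z]) auto
    next
      case 3
      then show ?thesis using ne by (intro shared[of y x z w]) auto
    next
      case 4
      then show ?thesis using ne by (intro shared[of y x w z]) auto
    qed
  qed
qed

lemma sep_family_step:
  assumes gr: "graph V E" and c: "\<And>v. v \<in> V \<Longrightarrow> c v < r" and r: "r \<ge> 1"
    and cls: "\<And>s. s < r \<Longrightarrow> sep_family (colour_class E c r s) n"
  shows "sep_family E (r * n + 4 * r)"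
proof -
  let ?sep = "\<lambda>e f (g :: 'a \<Rightarrow> int). (\<forall>a\<in>e. \<forall>b\<in>f. g a < g b) \<or> (\<forall>a\<in>e. \<forall>b\<in>f. g b < g a)"
  have "finite V" using gr by (simp add: graph_def)
  then obtain lab :: "'a \<Rightarrow> nat" and N where lab: "lab ` V = {i. i < N}" "inj_on lab V"
    using finite_imp_inj_to_nat_seg by blast
  have "\<forall>s\<in>{..<r}. \<exists>G. finite G \<and> card G \<le> n \<and>
     (\<forall>e\<in>colour_class E c r s. \<forall>f\<in>colour_class E c r s. e \<inter> f = {} \<longrightarrow> (\<exists>g\<in>G. ?sep e f g))"
    using cls by (simp add: sep_family_def)
  from bchoice[OF this] obtain G where *: "\<forall>s\<in>{..<r}. finite (G s) \<and> card (G s) \<le> n \<and>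
     (\<forall>e\<in>colour_class E c r s. \<forall>f\<in>colour_class E c r s. e \<inter> f = {} \<longrightarrow> (\<exists>g\<in>G s. ?sep e f g))"
    by (elim exE)
  then have G: "\<And>s. s < r \<Longrightarrow> finite (G s)" "\<And>s. s < r \<Longrightarrow> card (G s) \<le> n"
    by simp_all
  have Gsep: "\<exists>g\<in>G s. ?sep e f g"
    if "s < r" "e \<in> colour_class E c r s" "f \<in> colour_class E c r s" "e \<inter> f = {}" for s e f
    using * that by simp
  let ?I = "{..<r} \<times> (UNIV :: (bool \<times> bool) set)"
  define K where "K = block_key c lab N r ` ?I"
  define H where "H = (\<Union>s<r. G s) \<union> K"
  have "card H \<le> r * n + 4 * r"
  proof -
    have "card (\<Union>s<r. G s) \<le> (\<Sum>s<r. card (G s))" by (intro card_UN_le) simp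
    also have "\<dots> \<le> of_nat (card {..<r}) * n" using G by (intro sum_bounded_above) auto
    finally have "card (\<Union>s<r. G s) \<le> r * n" by simp
    moreover have "card K \<le> card ?I" unfolding K_def by (intro card_image_le) simp
    moreover have "card ?I = 4 * r" by (simp add: card_cartesian_product card_UNIV_bool flip: UNIV_Times_UNIV)
    ultimately show ?thesis unfolding H_def using card_Un_le[of "\<Union>s<r. G s" K] by linarith
  qed
  moreover have "finite H" using G by (auto simp: H_def K_def)
  moreover have "\<exists>g\<in>H. ?sep e f g" if e: "e \<in> E" and f: "f \<in> E" and ef: "e \<inter> f = {}" for e f
  proof -
    obtain x y where x: "e = {x, y}" "x \<in> V" "y \<in> V" using graph_edgeE[OF gr e] by metis
    obtain z w where z: "f = {z, w}" "z \<in> V" "w \<in> V" using graph_edgeE[OF gr f] by metis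
    have labN: "lab v < N" if "v \<in> V" for v using lab that by blast
    have K: "block_key c lab N r (c v, a, b) \<in> H" if "v \<in> V" for v a b
      using c that by (auto simp: H_def K_def)
    \<comment> \<open>Stated for both orders of the two edges, so that any of the four endpoints can
      play the vertex of minimal colour.\<close>
    have front: "\<exists>g\<in>H. ?sep {x, y} {z, w} g \<and> ?sep {z, w} {x, y} g"
      if "x \<in> V" "y \<in> V" "z \<in> V" "w \<in> V" "c x \<le> c y" "c x \<le> c z" "c x \<le> c w"
        "c ` {x, y} \<inter> c ` {z, w} = {}" for x y z w
      using block_key_separates_disjoint[of x y z w lab N c r] K[of y] labN that
      by (intro bexI[of _ "block_key c lab N r (c y, True, True)"]) auto
    show ?thesis
    proof (cases rule: colour_pairs_cases[of c x y z w])
      case disj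
      consider "c x \<le> c y" "c x \<le> c z" "c x \<le> c w" | "c y \<le> c x" "c y \<le> c z" "c y \<le> c w"
        | "c z \<le> c x" "c z \<le> c y" "c z \<le> c w" | "c w \<le> c x" "c w \<le> c y" "c w \<le> c z"
        by linarith
      then show ?thesis
      proof cases
        case 1
        then show ?thesis using front[of x y z w] disj x z by blast
      next
        case 2
        then show ?thesis using front[of y x z w] disj x z by (auto simp: insert_commute)
      next
        case 3
        then show ?thesis using front[of z w x y] disj x z by (auto simp: insert_commute)
      next
        case 4
        then show ?thesis using front[of w z x y] disj x z by (auto simp: insert_commute)
      qed
    next
      case same
      \<comment> \<open>A monochromatic \<open>e\<close> lies in every class, so \<open>f\<close>
        determines the residue. Otherwise \<open>e\<close> does, and \<open>f\<close> either has the
        same colour pair or is monochromatic.\<close>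
      define s where "s = (if c x = c y then c z + c w else c x + c y) mod r"
      have "s < r" using r by (simp add: s_def)
      moreover have "c x = c y \<or> (c x + c y) mod r = s" by (simp add: s_def)
      then have "e \<in> colour_class E c r s" using e x(1) by (auto simp: colour_class_def)
      moreover have "c z = c w \<or> (c z + c w) mod r = s"
        using same by (auto simp: s_def doubleton_eq_iff add.commute)
      then have "f \<in> colour_class E c r s" using f z(1) by (auto simp: colour_class_def)
      ultimately obtain g where "g \<in> G s" "?sep e f g" using Gsep ef by blast
      then show ?thesis using \<open>s < r\<close> by (auto simp: H_def)
    next
      case (shared x' y' z' w')
      have V: "x' \<in> V" "y' \<in> V" "z' \<in> V" "w' \<in> V" using shared(1,2) x z by auto
      have "y' \<in> e" "z' \<in> f" using shared(1,2) x(1) z(1) by auto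
      then have "y' \<noteq> z'" using ef by auto
      then have "lab y' \<noteq> lab z'" using lab(2) V by (auto dest: inj_onD)
      then have "\<exists>a b. ?sep {x', y'} {z', w'} (block_key c lab N r (c x', a, b))"
        using shared(3-6) V c labN by (intro block_key_separates_shared) auto
      then obtain a b where "?sep {x', y'} {z', w'} (block_key c lab N r (c x', a, b))"
        by (elim exE)
      then have "?sep e f (block_key c lab N r (c x', a, b))"
        by (simp only: shared(1,2) x(1) z(1))
      then show ?thesis using K[OF V(1)] by (rule bexI)
    qed
  qed
  ultimately show ?thesis unfolding sep_family_def by (intro exI[of _ H] conjI ballI impI)
qed

section \<open>The recursion and the induction on the maximum degree\<close>

lemma card_closed_neighbourhood:
  assumes gr: "graph V E" and "max_degree_le d V E" and v: "v \<in> V"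
  shows "card {w\<in>V. w = v \<or> {v, w} \<in> E} \<le> Suc d"
proof -
  have finV: "finite V" using gr by (simp add: graph_def)
  let ?N = "{w\<in>V. w \<noteq> v \<and> {v, w} \<in> E}"
  have "card ?N \<le> card {e\<in>E. v \<in> e}"
    using graph_finite_edges[OF gr] by (intro card_inj_on_le[of "\<lambda>w. {v, w}"])
      (auto simp: inj_on_def doubleton_eq_iff)
  also have "\<dots> \<le> d" using assms unfolding max_degree_le_def by blast
  finally have "card (insert v ?N) \<le> Suc d" using finV by (simp add: card_insert_if)
  moreover have "{w\<in>V. w = v \<or> {v, w} \<in> E} = insert v ?N" using v by blast
  ultimately show ?thesis by simp
qed

lemma sep_family_recursion:
  fixes V :: "'a set" and \<beta> :: real
  assumes gr: "graph V E" and deg: "max_degree_le d V E"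
    and t: "t \<ge> 1" and "\<beta> > 0" and "r \<ge> 1"
    and "\<beta> + real (Suc d) * real (d choose t) / \<beta> ^ (t - 1) \<le> real r"
    and IH: "\<And>E' :: 'a set set. graph V E' \<Longrightarrow> max_degree_le (2 * t - 1) V E' \<Longrightarrow> sep_family E' n"
  shows "sep_family E (r * n + 4 * r)"
proof -
  let ?S = "\<lambda>v. {w\<in>V. w = v \<or> {v, w} \<in> E}"
  have finV: "finite V" using gr by (simp add: graph_def)
  have S: "card (?S v) \<le> Suc d" if "v \<in> V" for v
    using card_closed_neighbourhood[OF gr deg that] .
  have S': "card {u\<in>V. v \<in> ?S u} \<le> Suc d" if "v \<in> V" for v
  proof -
    \<comment> \<open>Adjacency is symmetric, so the number of neighbourhoods containing
      \<open>v\<close> obeys the same bound as their size.\<close>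
    have "{u\<in>V. v \<in> ?S u} = ?S v" using that by (auto simp: insert_commute)
    then show ?thesis using S[OF that] by simp
  qed
  obtain c where c: "\<And>v. v \<in> V \<Longrightarrow> c v < r" "balanced V ?S t V c"
    by (rule balanced_colouring_exists[of V V ?S d t \<beta> r]) (use finV S S' assms in auto)
  have "sep_family (colour_class E c r s) n" for s
  proof (rule IH)
    show "graph V (colour_class E c r s)"
      using gr unfolding graph_def colour_class_def by blast
    show "max_degree_le (2 * t - 1) V (colour_class E c r s)"
      by (rule max_degree_colour_class[OF gr _ c(2)]) (rule c(1))
  qed
  then show ?thesis
    by (intro sep_family_step[OF gr, where c = c]) (use c(1) \<open>r \<ge> 1\<close> in auto)
qed

lemma sep_family_bound:
  fixes V :: "'a set"
  assumes "d \<ge> 1" "graph V E" "max_degree_le d V E"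
  shows "sep_family E (nat \<lfloor>2 powr (9 * real (logstar (real d))) * real d\<rfloor>)"
  using assms
proof (induction d arbitrary: E rule: less_induct)
  case (less d)
  let ?f = "\<lambda>d::nat. 2 powr (9 * real (logstar (real d))) * real d"
  consider "d = 1" | "d = 2 \<or> d = 3" | "d \<ge> 4" using less.prems by linarith
  then show ?case
  proof cases
    case 1
    then show ?thesis using sep_family_matching less.prems by (auto simp: logstar_eq_0)
  next
    case 2
    \<comment> \<open>The general parameters require \<open>d \<ge> 4\<close>. With
      \<open>t = 1\<close> and \<open>\<beta> = 1\<close> the counting condition holds with equality
      and the colour classes are matchings; \<open>5 * ?r\<close> is 35 or 65, far below
      \<open>512 * d\<close>.\<close>
    let ?r = "1 + Suc d * d"
    have "sep_family E (?r * 1 + 4 * ?r)"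
    proof (rule sep_family_recursion[where t = 1 and \<beta> = 1, OF less.prems(2,3)])
      show "sep_family E' 1" if "graph V E'" "max_degree_le (2 * 1 - 1) V E'" for E' :: "'a set set"
        using sep_family_matching[OF that(1)] that(2) by simp
    qed (auto simp: algebra_simps)
    moreover have "logstar (real d) = Suc (logstar (log 2 (real d)))"
      using 2 by (intro logstar_rec) auto
    then have "?f d = 512 * 2 powr (9 * real (logstar (log 2 (real d)))) * real d"
      by (simp only: powr_9_Suc)
    moreover have "2 powr (9 * real (logstar (log 2 (real d)))) \<ge> 1"
      by (intro ge_one_powr_ge_zero) auto
    ultimately have "?r * 1 + 4 * ?r \<le> nat \<lfloor>?f d\<rfloor>" using 2 by (auto simp: le_nat_iff le_floor_iff)
    then show ?thesis using \<open>sep_family E (?r * 1 + 4 * ?r)\<close> sep_family_mono by blast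
  next
    case 3
    then obtain t r \<beta> where *: "t \<ge> 1" "\<beta> > 0" "r \<ge> 1" "2 * t - 1 < d"
      "\<beta> + real (Suc d) * real (d choose t) / \<beta> ^ (t - 1) \<le> real r"
      "real r * ?f (2 * t - 1) + 4 * real r \<le> ?f d"
      by (rule recursion_parameters)
    define n where "n = nat \<lfloor>?f (2 * t - 1)\<rfloor>"
    have "sep_family E (r * n + 4 * r)"
    proof (rule sep_family_recursion[OF less.prems(2,3) *(1,2,3,5)])
      fix E' :: "'a set set"
      assume "graph V E'" "max_degree_le (2 * t - 1) V E'"
      then show "sep_family E' n" unfolding n_def using * by (intro less.IH) auto
    qed
    moreover have "r * n + 4 * r \<le> nat \<lfloor>?f d\<rfloor>"
    proof -
      have "real n \<le> ?f (2 * t - 1)" unfolding n_def by simp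
      then have "real r * real n \<le> real r * ?f (2 * t - 1)" by (intro mult_left_mono) auto
      then have "real (r * n + 4 * r) \<le> ?f d" using *(6) by simp
      then show ?thesis by (simp add: le_nat_iff le_floor_iff)
    qed
    ultimately show ?thesis by (rule sep_family_mono)
  qed
qed

theorem theorem1:
  fixes V :: "'a set" and E :: "'a set set" and d :: nat
  assumes "d > 0" and "graph V E" and "regular d V E"
  shows "real (separation_dim V E) \<le> 2 powr (9 * real (logstar (real d))) * real d"
proof -
  have "max_degree_le d V E" using assms(3) by (simp add: regular_def max_degree_le_def)
  then have "sep_family E (nat \<lfloor>2 powr (9 * real (logstar (real d))) * real d\<rfloor>)"
    using assms by (intro sep_family_bound) auto
  from separation_dim_le[OF assms(2) this]
  have "real (separation_dim V E) \<le> real (nat \<lfloor>2 powr (9 * real (logstar (real d))) * real d\<rfloor>)"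
    by (rule of_nat_mono)
  also have "\<dots> \<le> 2 powr (9 * real (logstar (real d))) * real d" by simp
  finally show ?thesis .
qed

end
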